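(* Let $G$ and $H$ be two finite connected multigraphs without loops, and let ${\bf e}_H$ be the identity element of the sandpile group $SP(c(H),s_{c(H)})$ of the cone of $H$. Then the mapping $\widetilde{\pi}_G: SP(c(G), s_{c(G)})\rightarrow SP(c(G\Box H), s_{c(G\Box H)})$ given by \[ \widetilde{\pi}_G ({\bf a})={\bf a}\Box {\bf e}_H \] is (well defined and) an injective homomorphism of groups.
   Context: Multigraphs may have parallel edges; $m_{x,y}$ is the number of edges joining $x$ and $y$. The cone $c(G)$ of $G$ is obtained by adding a new vertex $s_{c(G)}$ and exactly one edge between it and each vertex of $G$; the sink of $c(G)$ is $s_{c(G)}$. The cartesian product $G\Box H$ has vertex set $V(G)\times V(H)$, and $(u_1,v_1)$, $(u_2,v_2)$ are adjacent iff either $u_1=u_2$ and $v_1v_2\in E(H)$ (with the multiplicity of $v_1v_2$ in $H$), or $v_1=v_2$ and $u_1u_2\in E(G)$ (with the multiplicity of $u_1u_2$ in $G$). For configurations ${\bf a}\in\mathbb{N}^{V(G)}$ of $c(G)$ and ${\bf b}\in\mathbb{N}^{V(H)}$ of $c(H)$, the configuration ${\bf a}\Box{\bf b}\in\mathbb{N}^{V(G\Box H)}$ of $c(G\Box H)$ is given by $({\bf a}\Box {\bf b})_{(u,v)}={\bf a}_u+{\bf b}_v$. Sandpile group of a connected multigraph $\Gamma$ with sink $s$: let $\widetilde V=V(\Gamma)\setminus\{s\}$. A configuration is a vector ${\bf c}\in\mathbb{N}^{\widetilde V}$ (with $0\in\mathbb{N}$). A vertex $v\in\widetilde V$ is stable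 in ${\bf c}$ if ${\bf c}_v<d_\Gamma(v)$ (degree in $\Gamma$, counting multiplicities) and unstable otherwise; ${\bf c}$ is stable if all $v\in\widetilde V$ are stable. Toppling an unstable vertex $u$ decreases ${\bf c}_u$ by $d_\Gamma(u)$ and increases ${\bf c}_v$ by $m_{u,v}$ for every $v\in\widetilde V\setminus\{u\}$. Every configuration reaches by topplings of unstable vertices a unique stable configuration $s({\bf c})$. A configuration ${\bf c}$ is recurrent if it is stable and there is a non-zero configuration ${\bf r}$ such that $s({\bf c}+{\bf r})={\bf c}$. The sandpile group $SP(\Gamma,s)$ is the set of recurrent configurations with the operation ${\bf c}\oplus{\bf d}=s({\bf c}+{\bf d})$; it is a finite abelian group (here $\Gamma\setminus s$ is connected). *)

theory Defs
  imports "HOL-Algebra.Group"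
begin

text \<open>A multigraph is given by its vertices and by the number \<open>edge_mult G x y\<close> of edges joining
  \<open>x\<close> and \<open>y\<close>; individual parallel edges carry no identity.\<close>

record 'a multigraph =
  verts :: "'a set"
  edge_mult :: "'a \<Rightarrow> 'a \<Rightarrow> nat"

locale finite_multigraph =
  fixes G :: "'a multigraph"
  assumes finite_verts: "finite (verts G)"
    and edge_mult_sym: "edge_mult G x y = edge_mult G y x"
    and edge_mult_outside: "x \<notin> verts G \<Longrightarrow> edge_mult G x y = 0"

definition loopless :: "'a multigraph \<Rightarrow> bool" where
  "loopless G \<longleftrightarrow> (\<forall>x\<in>verts G. edge_mult G x x = 0)"

definition adjacent :: "'a multigraph \<Rightarrow> 'a \<Rightarrow> 'a \<Rightarrow> bool" where
  "adjacent G x y \<longleftrightarrow> x \<in> verts G \<and> y \<in> verts G \<and> edge_mult G x y > 0"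

text \<open>The graph without vertices does not count as connected.\<close>

definition connected_multigraph :: "'a multigraph \<Rightarrow> bool" where
  "connected_multigraph G \<longleftrightarrow>
     verts G \<noteq> {} \<and> (\<forall>x\<in>verts G. \<forall>y\<in>verts G. (adjacent G)\<^sup>*\<^sup>* x y)"

text \<open>Each edge is counted once at \<open>x\<close>; only loopless graphs are considered.\<close>

definition degree :: "'a multigraph \<Rightarrow> 'a \<Rightarrow> nat" where
  "degree G x = (\<Sum>y\<in>verts G. edge_mult G x y)"


subsection \<open>Cones and cartesian products\<close>

text \<open>The vertices of the cone are \<open>Some x\<close> for the vertices \<open>x\<close> of \<open>G\<close>, and the new vertex \<open>None\<close>.\<close>

abbreviation cone_sink :: "'a option" where
  "cone_sink \<equiv> None"

fun cone_mult :: "'a multigraph \<Rightarrow> 'a option \<Rightarrow> 'a option \<Rightarrow> nat" where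
  "cone_mult G (Some x) (Some y) = edge_mult G x y"
| "cone_mult G (Some x) None = (if x \<in> verts G then 1 else 0)"
| "cone_mult G None (Some y) = (if y \<in> verts G then 1 else 0)"
| "cone_mult G None None = 0"

definition cone :: "'a multigraph \<Rightarrow> 'a option multigraph" where
  "cone G = \<lparr>verts = insert cone_sink (Some ` verts G), edge_mult = cone_mult G\<rparr>"

text \<open>For loopless graphs at most one of the two summands is nonzero. The guards only ensure that
  pairs outside the vertex set carry no edges.\<close>

definition cart_prod :: "'a multigraph \<Rightarrow> 'b multigraph \<Rightarrow> ('a \<times> 'b) multigraph" where
  "cart_prod G H =
     \<lparr>verts = verts G \<times> verts H,
      edge_mult = (\<lambda>(u1, v1) (u2, v2).
        (if u1 = u2 \<and> u1 \<in> verts G then edge_mult H v1 v2 else 0) +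
        (if v1 = v2 \<and> v1 \<in> verts H then edge_mult G u1 u2 else 0))\<rparr>"


subsection \<open>Sandpile groups\<close>

text \<open>A configuration is a vector indexed by the non-sink vertices, encoded as a function that is
  0 everywhere else (in particular at the sink).\<close>

definition configs :: "'a multigraph \<Rightarrow> 'a \<Rightarrow> ('a \<Rightarrow> nat) set" where
  "configs \<Gamma> s = {c. \<forall>v. v \<notin> verts \<Gamma> - {s} \<longrightarrow> c v = 0}"

definition conf_add :: "('a \<Rightarrow> nat) \<Rightarrow> ('a \<Rightarrow> nat) \<Rightarrow> 'a \<Rightarrow> nat" where
  "conf_add c d = (\<lambda>v. c v + d v)"

definition stable :: "'a multigraph \<Rightarrow> 'a \<Rightarrow> ('a \<Rightarrow> nat) \<Rightarrow> bool" where
  "stable \<Gamma> s c \<longleftrightarrow> (\<forall>v\<in>verts \<Gamma> - {s}. c v < degree \<Gamma> v)"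

definition topple :: "'a multigraph \<Rightarrow> 'a \<Rightarrow> 'a \<Rightarrow> ('a \<Rightarrow> nat) \<Rightarrow> 'a \<Rightarrow> nat" where
  "topple \<Gamma> s u c =
     (\<lambda>v. if v = u then c v - degree \<Gamma> u
          else if v \<in> verts \<Gamma> - {s} then c v + edge_mult \<Gamma> u v
          else c v)"

definition topple_step :: "'a multigraph \<Rightarrow> 'a \<Rightarrow> ('a \<Rightarrow> nat) \<Rightarrow> ('a \<Rightarrow> nat) \<Rightarrow> bool" where
  "topple_step \<Gamma> s c d \<longleftrightarrow>
     (\<exists>u\<in>verts \<Gamma> - {s}. degree \<Gamma> u \<le> c u \<and> d = topple \<Gamma> s u c)"

definition stabilize :: "'a multigraph \<Rightarrow> 'a \<Rightarrow> ('a \<Rightarrow> nat) \<Rightarrow> 'a \<Rightarrow> nat" where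
  "stabilize \<Gamma> s c = (THE d. (topple_step \<Gamma> s)\<^sup>*\<^sup>* c d \<and> stable \<Gamma> s d)"

definition recurrent :: "'a multigraph \<Rightarrow> 'a \<Rightarrow> ('a \<Rightarrow> nat) \<Rightarrow> bool" where
  "recurrent \<Gamma> s c \<longleftrightarrow>
     c \<in> configs \<Gamma> s \<and> stable \<Gamma> s c \<and>
     (\<exists>r\<in>configs \<Gamma> s. r \<noteq> (\<lambda>_. 0) \<and> stabilize \<Gamma> s (conf_add c r) = c)"

definition sandpile_op ::
    "'a multigraph \<Rightarrow> 'a \<Rightarrow> ('a \<Rightarrow> nat) \<Rightarrow> ('a \<Rightarrow> nat) \<Rightarrow> 'a \<Rightarrow> nat" where
  "sandpile_op \<Gamma> s c d = stabilize \<Gamma> s (conf_add c d)"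

text \<open>The identity of the sandpile group is usually not the zero configuration, which need not be
  recurrent.\<close>

definition sandpile_identity :: "'a multigraph \<Rightarrow> 'a \<Rightarrow> 'a \<Rightarrow> nat" where
  "sandpile_identity \<Gamma> s =
     (THE e. recurrent \<Gamma> s e \<and>
        (\<forall>c. recurrent \<Gamma> s c \<longrightarrow> sandpile_op \<Gamma> s e c = c \<and> sandpile_op \<Gamma> s c e = c))"

definition sandpile_group :: "'a multigraph \<Rightarrow> 'a \<Rightarrow> ('a \<Rightarrow> nat) monoid" where
  "sandpile_group \<Gamma> s =
     \<lparr>carrier = {c. recurrent \<Gamma> s c},
      monoid.mult = sandpile_op \<Gamma> s,
      one = sandpile_identity \<Gamma> s\<rparr>"

text \<open>\<open>box_conf G H a b\<close> takes configurations \<open>a\<close> of \<open>cone G\<close> and \<open>b\<close> of \<open>cone H\<close> to a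
  configuration of \<open>cone (cart_prod G H)\<close>.\<close>

definition box_conf ::
    "'a multigraph \<Rightarrow> 'b multigraph \<Rightarrow> ('a option \<Rightarrow> nat) \<Rightarrow> ('b option \<Rightarrow> nat) \<Rightarrow>
     ('a \<times> 'b) option \<Rightarrow> nat" where
  "box_conf G H a b = (\<lambda>w. case w of
       None \<Rightarrow> 0
     | Some (u, v) \<Rightarrow> if u \<in> verts G \<and> v \<in> verts H then a (Some u) + b (Some v) else 0)"

end

theory Submission
  imports Defs
begin

text \<open>Modulo the image of the Laplacian, \<open>(a, b) \<mapsto> a \<box> b\<close> is additive, because the Laplacian of the
  cone of \<open>G \<box> H\<close> at a script of the form \<open>x u + y v\<close> is the sum of those of the cones of \<open>G\<close> and
  \<open>H\<close> at \<open>x\<close> and \<open>y\<close>. As every class contains exactly one recurrent configuration, it remains to see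
  that \<open>a \<box> b\<close> is recurrent whenever \<open>a\<close> and \<open>b\<close> are. By Dhar's criterion a stable configuration is
  recurrent iff it has no forbidden subconfiguration; a set \<open>F\<close> that is forbidden for \<open>a \<box> b\<close> would
  have a projection to \<open>G\<close> that is forbidden for \<open>a\<close>, or a fibre that is forbidden for \<open>b\<close>.\<close>

section \<open>Legal topplings and the Laplacian\<close>

text \<open>The last assumption is connectedness of the graph without its sink, phrased as: it has no
  nonempty proper set of vertices that is closed under adjacency.\<close>

locale sandpile = finite_multigraph \<Gamma> for \<Gamma> :: "'a multigraph" +
  fixes s :: 'a
  assumes sink_in_verts: "s \<in> verts \<Gamma>"
    and no_loop: "edge_mult \<Gamma> v v = 0"
    and sink_adjacent: "v \<in> verts \<Gamma> - {s} \<Longrightarrow> 0 < edge_mult \<Gamma> s v"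
    and nonsink_nonempty: "verts \<Gamma> - {s} \<noteq> {}"
    and nonsink_connected: "W \<subseteq> verts \<Gamma> - {s} \<Longrightarrow> W \<noteq> {} \<Longrightarrow>
      (\<And>u v. u \<in> W \<Longrightarrow> v \<in> verts \<Gamma> - {s} \<Longrightarrow> 0 < edge_mult \<Gamma> u v \<Longrightarrow> v \<in> W) \<Longrightarrow>
      W = verts \<Gamma> - {s}"
begin

abbreviation V where "V \<equiv> verts \<Gamma> - {s}"

abbreviation m where "m \<equiv> edge_mult \<Gamma>"

declare finite_verts [simp]

lemma finite_V: "finite V"
  by simp

lemma sum_verts: "(\<Sum>v\<in>verts \<Gamma>. f v) = f s + (\<Sum>v\<in>V. f v)" for f :: "'a \<Rightarrow> 'c::comm_monoid_add"
  by (rule sum.remove[OF finite_verts sink_in_verts])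

text \<open>The Laplacian of the whole graph, sink included. On scripts with \<open>z s = 0\<close>
  it is the reduced Laplacian, whose image is the trivial class of the sandpile group.\<close>

definition laplacian :: "('a \<Rightarrow> int) \<Rightarrow> 'a \<Rightarrow> int" where
  "laplacian z v = (\<Sum>u\<in>verts \<Gamma>. int (m u v) * (z v - z u))"

lemma laplacian_add: "laplacian (\<lambda>v. y v + z v) v = laplacian y v + laplacian z v"
  unfolding laplacian_def by (simp add: algebra_simps flip: sum.distrib)

lemma laplacian_diff: "laplacian (\<lambda>v. y v - z v) v = laplacian y v - laplacian z v"
  unfolding laplacian_def by (simp add: algebra_simps flip: sum_subtractf)

lemma laplacian_0 [simp]: "laplacian (\<lambda>_. 0) v = 0"
  unfolding laplacian_def by simp

lemma laplacian_uminus: "laplacian (\<lambda>v. - z v) v = - laplacian z v"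
  using laplacian_diff[of "\<lambda>_. 0" z v] by simp

lemma laplacian_single:
  assumes "u \<in> V"
  shows "laplacian (\<lambda>w. if w = u then 1 else 0) v
    = (if v = u then int (degree \<Gamma> u) else - int (m u v))"
proof (cases "v = u")
  case True
  have "int (m w u) * (1 - (if w = u then 1 else 0)) = int (m u w)" for w
    by (cases "w = u") (auto simp: no_loop edge_mult_sym[of w u])
  then show ?thesis
    using True by (simp add: laplacian_def degree_def)
next
  case False
  have "laplacian (\<lambda>w. if w = u then 1 else 0) v = (\<Sum>w\<in>verts \<Gamma>. if w = u then - int (m u v) else 0)"
    unfolding laplacian_def using False by (intro sum.cong) auto
  then show ?thesis
    using False assms finite_verts by simp
qed

text \<open>\<open>topples c x d\<close>: some sequence of legal topplings that topples each \<open>v\<close> exactly \<open>x v\<close> times leads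
  from \<open>c\<close> to \<open>d\<close>.\<close>

inductive topples :: "('a \<Rightarrow> nat) \<Rightarrow> ('a \<Rightarrow> nat) \<Rightarrow> ('a \<Rightarrow> nat) \<Rightarrow> bool" for c where
  refl: "topples c (\<lambda>_. 0) c"
| step: "topples c x d \<Longrightarrow> u \<in> V \<Longrightarrow> degree \<Gamma> u \<le> d u \<Longrightarrow>
    topples c (x(u := Suc (x u))) (topple \<Gamma> s u d)"

lemma topples_iff_steps: "(topple_step \<Gamma> s)\<^sup>*\<^sup>* c d \<longleftrightarrow> (\<exists>x. topples c x d)"
proof
  assume "(topple_step \<Gamma> s)\<^sup>*\<^sup>* c d"
  then show "\<exists>x. topples c x d"
    by induction (auto simp: topple_step_def intro: topples.intros)
next
  assume "\<exists>x. topples c x d"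
  then obtain x where "topples c x d" ..
  then show "(topple_step \<Gamma> s)\<^sup>*\<^sup>* c d"
  proof induction
    case (step x d u)
    then have "topple_step \<Gamma> s d (topple \<Gamma> s u d)"
      unfolding topple_step_def by blast
    with step.IH show ?case
      by (meson rtranclp.rtrancl_into_rtrancl)
  qed simp
qed

text \<open>The second leg comes first among the assumptions because the induction runs over
  it.\<close>

lemma topples_trans:
  assumes "topples d y e" "topples c x d"
  shows "topples c (\<lambda>v. x v + y v) e"
  using assms
proof induction
  case (step y e u)
  then have "topples c ((\<lambda>v. x v + y v)(u := Suc (x u + y u))) (topple \<Gamma> s u e)"
    by (intro topples.step) auto
  then show ?case
    by (simp add: fun_upd_def if_distrib cong: if_cong)
qed simp

text \<open>Extra chips never make a toppling illegal, and since \<open>u\<close> holds enough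
  chips, the truncated subtraction in \<open>topple\<close> commutes with adding
  \<open>r\<close>.\<close>

lemma topples_add:
  assumes "topples c x d"
  shows "topples (conf_add c r) x (conf_add d r)"
  using assms
proof induction
  case refl
  show ?case by (rule topples.refl)
next
  case (step x d u)
  have "topple \<Gamma> s u (conf_add d r) = conf_add (topple \<Gamma> s u d) r"
    using step.hyps by (auto simp: topple_def conf_add_def fun_eq_iff)
  moreover have "topples (conf_add c r) (x(u := Suc (x u))) (topple \<Gamma> s u (conf_add d r))"
    using step by (intro topples.step) (auto simp: conf_add_def)
  ultimately show ?case by (simp del: fun_upd_apply)
qed

lemma topples_outside:
  assumes "topples c x d" "v \<notin> V"
  shows "x v = 0" "d v = c v"
  using assms by (induction) (auto simp: topple_def)

lemma topples_configs: "topples c x d \<Longrightarrow> c \<in> configs \<Gamma> s \<Longrightarrow> d \<in> configs \<Gamma> s"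
  using topples_outside(2) by (fastforce simp: configs_def)

lemma topples_balance:
  assumes "topples c x d" "v \<in> V"
  shows "int (d v) = int (c v) - laplacian (\<lambda>v. int (x v)) v"
  using assms
proof induction
  case (step x d u)
  have "(\<lambda>w. int ((x(u := Suc (x u))) w)) = (\<lambda>w. int (x w) + (if w = u then 1 else 0))"
    by auto
  then have "laplacian (\<lambda>w. int ((x(u := Suc (x u))) w)) v
      = laplacian (\<lambda>w. int (x w)) v + laplacian (\<lambda>w. if w = u then 1 else 0) v"
    using laplacian_add[of "\<lambda>w. int (x w)" "\<lambda>w. if w = u then 1 else 0" v] by simp
  then show ?case
    using step by (auto simp: laplacian_single topple_def)
qed simp

text \<open>The script \<open>y\<close> need not be legal in any order. If \<open>x\<close> were
  about to exceed \<open>y\<close> for the first time, at \<open>u\<close>, then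
  \<open>x \<le> y\<close> everywhere with equality at \<open>u\<close>; hence \<open>y\<close>
  leaves at least as many chips on \<open>u\<close> as \<open>x\<close> does, and \<open>u\<close>
  would be unstable after \<open>y\<close>.\<close>

lemma least_action:
  assumes "topples c x d"
    and y: "y s = 0" "\<And>v. v \<in> V \<Longrightarrow> 0 \<le> y v"
    and y_stable: "\<And>v. v \<in> V \<Longrightarrow> int (c v) - laplacian y v < int (degree \<Gamma> v)"
    and "v \<in> V"
  shows "int (x v) \<le> y v"
  using assms(1) \<open>v \<in> V\<close>
proof (induction arbitrary: v)
  case (step x d u)
  have "int (x u) \<noteq> y u"
  proof
    assume eq: "int (x u) = y u"
    have xy: "int (x w) \<le> y w" if "w \<in> verts \<Gamma>" for w
      using that step.IH y(1) topples_outside(1)[OF step.hyps(1), of s] by (cases "w = s") auto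
    have "laplacian y u \<le> laplacian (\<lambda>w. int (x w)) u"
      unfolding laplacian_def using xy eq by (intro sum_mono mult_left_mono) auto
    then show False
      using topples_balance[OF step.hyps(1,2)] y_stable[OF step.hyps(2)] step.hyps(3) by linarith
  qed
  then show ?case
    using step.IH[OF step.prems] step.IH[OF step.hyps(2)] by auto
qed (use y in auto)

section \<open>Stabilization\<close>

text \<open>Every non-sink vertex is adjacent to the sink, so each toppling loses a chip there. This
  is the termination measure for stabilization.\<close>

lemma topple_step_decreases:
  assumes "topple_step \<Gamma> s c d"
  shows "(\<Sum>v\<in>V. d v) < (\<Sum>v\<in>V. c v)"
proof -
  obtain u where u: "u \<in> V" "degree \<Gamma> u \<le> c u" and d: "d = topple \<Gamma> s u c"
    using assms by (auto simp: topple_step_def)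
  have "(\<Sum>v\<in>V. d v) + degree \<Gamma> u = (\<Sum>v\<in>V. c v) + (\<Sum>v\<in>V. m u v)"
  proof -
    have "(\<Sum>v\<in>V - {u}. d v) = (\<Sum>v\<in>V - {u}. c v) + (\<Sum>v\<in>V - {u}. m u v)"
      unfolding sum.distrib[symmetric] d by (intro sum.cong) (auto simp: topple_def)
    then show ?thesis
      using u by (simp add: sum.remove[OF finite_V u(1)] no_loop d topple_def)
  qed
  moreover have "(\<Sum>v\<in>V. m u v) < degree \<Gamma> u"
    using sink_adjacent[OF u(1)] by (simp add: degree_def sum_verts edge_mult_sym[of u s])
  ultimately show ?thesis by linarith
qed

lemma ex_stabilization: "\<exists>x d. topples c x d \<and> stable \<Gamma> s d"
proof -
  have "\<exists>d. (topple_step \<Gamma> s)\<^sup>*\<^sup>* c d \<and> stable \<Gamma> s d"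
  proof (induction c rule: measure_induct_rule[where f = "\<lambda>c. \<Sum>v\<in>V. c v"])
    case (less c)
    show ?case
    proof (cases "stable \<Gamma> s c")
      case False
      then obtain u where u: "u \<in> V" "degree \<Gamma> u \<le> c u"
        unfolding stable_def by (meson not_less)
      then have step: "topple_step \<Gamma> s c (topple \<Gamma> s u c)"
        by (auto simp: topple_step_def)
      from less[OF topple_step_decreases[OF this]] step show ?thesis
        by (meson converse_rtranclp_into_rtranclp)
    qed auto
  qed
  then show ?thesis
    by (auto simp: topples_iff_steps)
qed

text \<open>By least action, each of two stabilizing scripts is bounded by the other; the script
  then determines the final configuration.\<close>

lemma stabilization_unique:
  assumes "topples c x d" "stable \<Gamma> s d" "topples c y e" "stable \<Gamma> s e"
  shows "x = y" "d = e"
proof -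
  have le: "x v \<le> y v"
    if "topples c x d" "topples c y e" "stable \<Gamma> s e" for x d y e v
  proof (cases "v \<in> V")
    case True
    have "int (x v) \<le> int (y v)"
    proof (rule least_action[OF that(1) _ _ _ True])
      fix w assume w: "w \<in> V"
      have "int (e w) < int (degree \<Gamma> w)"
        using that(3) w by (simp add: stable_def)
      then show "int (c w) - laplacian (\<lambda>v. int (y v)) w < int (degree \<Gamma> w)"
        using topples_balance[OF that(2) w] by linarith
    qed (use topples_outside(1)[OF that(2), of s] in auto)
    then show ?thesis by simp
  qed (simp add: topples_outside(1)[OF that(1)])
  show xy: "x = y"
    using le[OF assms(1,3,4)] le[OF assms(3,1,2)] by (auto simp: fun_eq_iff intro: antisym)
  show "d = e"
  proof
    fix v
    show "d v = e v"
      using topples_balance[OF assms(1), of v] topples_balance[OF assms(3), of v] xy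
        topples_outside(2)[OF assms(1), of v] topples_outside(2)[OF assms(3), of v]
      by (cases "v \<in> V") auto
  qed
qed

lemma stabilize_eqI:
  assumes "topples c x d" "stable \<Gamma> s d"
  shows "stabilize \<Gamma> s c = d"
  unfolding stabilize_def
  using assms stabilization_unique(2) by (intro the_equality) (auto simp: topples_iff_steps)

lemma stabilize_topples:
  obtains x where "topples c x (stabilize \<Gamma> s c)"
  using ex_stabilization[of c] stabilize_eqI by blast

lemma stable_stabilize: "stable \<Gamma> s (stabilize \<Gamma> s c)"
  using ex_stabilization[of c] stabilize_eqI by blast

lemma stabilize_configs: "c \<in> configs \<Gamma> s \<Longrightarrow> stabilize \<Gamma> s c \<in> configs \<Gamma> s"
  by (metis stabilize_topples topples_configs)

text \<open>Stabilizing \<open>c\<close> in the presence of \<open>r\<close> and then the rest is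
  one toppling sequence from \<open>c + r\<close>, so uniqueness applies.\<close>

lemma stabilize_add_stabilize:
  "stabilize \<Gamma> s (conf_add (stabilize \<Gamma> s c) r) = stabilize \<Gamma> s (conf_add c r)"
proof -
  obtain x where x: "topples c x (stabilize \<Gamma> s c)"
    by (rule stabilize_topples)
  obtain y where y: "topples (conf_add (stabilize \<Gamma> s c) r) y
      (stabilize \<Gamma> s (conf_add (stabilize \<Gamma> s c) r))"
    by (rule stabilize_topples)
  show ?thesis
    by (rule stabilize_eqI[OF topples_trans[OF y topples_add[OF x]] stable_stabilize, symmetric])
qed

lemma conf_add_commute: "conf_add c d = conf_add d c"
  by (auto simp: conf_add_def)

lemma conf_add_assoc: "conf_add (conf_add c d) e = conf_add c (conf_add d e)"
  by (auto simp: conf_add_def)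

lemma conf_add_configs: "c \<in> configs \<Gamma> s \<Longrightarrow> d \<in> configs \<Gamma> s \<Longrightarrow> conf_add c d \<in> configs \<Gamma> s"
  by (auto simp: configs_def conf_add_def)

lemma sandpile_op_commute: "sandpile_op \<Gamma> s c d = sandpile_op \<Gamma> s d c"
  by (simp add: sandpile_op_def conf_add_commute)

text \<open>Absorbing the inner stabilization turns both sides into the stabilization of
  \<open>c + d + e\<close>.\<close>

lemma sandpile_op_assoc:
  "sandpile_op \<Gamma> s (sandpile_op \<Gamma> s c d) e = sandpile_op \<Gamma> s c (sandpile_op \<Gamma> s d e)"
  unfolding sandpile_op_def
  by (subst (1 2) conf_add_commute, subst stabilize_add_stabilize)
    (simp add: conf_add_assoc conf_add_commute[of _ c] stabilize_add_stabilize)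

section \<open>Recurrence\<close>

text \<open>A nonempty set \<open>F\<close> is a forbidden subconfiguration if each of its vertices
  holds fewer chips than it has edges into \<open>F\<close>.\<close>

definition no_forbidden :: "('a \<Rightarrow> nat) \<Rightarrow> bool" where
  "no_forbidden c \<longleftrightarrow> (\<forall>F\<subseteq>V. F \<noteq> {} \<longrightarrow> (\<exists>v\<in>F. (\<Sum>u\<in>F. m u v) \<le> c v))"

text \<open>The witness is the vertex of \<open>F\<close> whose last toppling comes first: it afterwards receives a chip
  along every edge from \<open>F\<close>.\<close>

lemma topples_no_forbidden:
  assumes "topples c x d" "F \<subseteq> V" "F \<noteq> {}" "\<And>v. v \<in> F \<Longrightarrow> 0 < x v"
  shows "\<exists>v\<in>F. (\<Sum>u\<in>F. m u v) \<le> d v"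
  using assms
proof (induction arbitrary: F)
  case (step x d u)
  have finF: "finite F"
    using step.prems(1) finite_V by (rule finite_subset)
  show ?case
  proof (cases "u \<in> F")
    case False
    then have "0 < x v" if "v \<in> F" for v
      using step.prems(3)[OF that] that by (auto split: if_splits)
    then obtain v where v: "v \<in> F" "(\<Sum>u\<in>F. m u v) \<le> d v"
      using step.IH[of F] step.prems(1,2) by blast
    then have "d v \<le> topple \<Gamma> s u d v"
      using False by (auto simp: topple_def)
    with v show ?thesis by force
  next
    case True
    show ?thesis
    proof (cases "F = {u}")
      case False
      \<comment> \<open>The other vertices of \<open>F\<close> have toppled before, so the induction
        hypothesis gives a witness for \<open>F - {u}\<close>; the toppling of \<open>u\<close>
        supplies the missing \<open>m u v\<close> chips. For \<open>F = {u}\<close> the sum is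
        \<open>m u u = 0\<close>.\<close>
      have "0 < x v" if "v \<in> F - {u}" for v
        using step.prems(3)[of v] that by (auto split: if_splits)
      then obtain v where v: "v \<in> F - {u}" "(\<Sum>u\<in>F - {u}. m u v) \<le> d v"
        using step.IH[of "F - {u}"] step.prems(1,2) True False by blast
      then have "(\<Sum>u\<in>F. m u v) \<le> topple \<Gamma> s u d v"
        using step.prems(1) by (auto simp: topple_def sum.remove[OF finF True])
      with v show ?thesis by blast
    qed (simp add: no_loop)
  qed
qed auto

text \<open>The topplings \<open>x\<close> that lead from \<open>c + r\<close> back to
  \<open>c\<close> satisfy \<open>laplacian x = r\<close>. They turn out to involve every vertex, so
  the preceding lemma applies to every \<open>F\<close>.\<close>

lemma recurrent_no_forbidden:
  assumes "recurrent \<Gamma> s c"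
  shows "no_forbidden c"
proof -
  obtain r where r: "r \<in> configs \<Gamma> s" "r \<noteq> (\<lambda>_. 0)" "stabilize \<Gamma> s (conf_add c r) = c"
    using assms by (auto simp: recurrent_def)
  obtain x where x: "topples (conf_add c r) x c"
    using stabilize_topples[of "conf_add c r"] r(3) by auto
  have lap: "laplacian (\<lambda>v. int (x v)) v = int (r v)" if "v \<in> V" for v
    using topples_balance[OF x that] by (simp add: conf_add_def)
  define W where "W = {v \<in> V. x v = 0}"
  \<comment> \<open>A minimum principle: where \<open>x u = 0\<close>, the nonnegative
    \<open>laplacian x u\<close> is minus a sum of nonnegative terms, so \<open>x\<close> vanishes
    at all neighbours of \<open>u\<close>. By connectedness one zero forces \<open>x = 0\<close>,
    hence \<open>r = 0\<close>.\<close>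
  have "W = {}"
  proof (rule ccontr)
    assume "W \<noteq> {}"
    have "W = V"
    proof (rule nonsink_connected)
      fix u v assume u: "u \<in> W" and v: "v \<in> V" and "0 < m u v"
      have nonneg: "\<forall>w\<in>verts \<Gamma>. 0 \<le> int (m w u) * int (x w)"
        by simp
      have "(\<Sum>w\<in>verts \<Gamma>. int (m w u) * int (x w)) = - laplacian (\<lambda>v. int (x v)) u"
        using u by (simp add: W_def laplacian_def sum_negf)
      also have "\<dots> \<le> 0"
        using lap[of u] u by (simp add: W_def)
      finally have "(\<Sum>w\<in>verts \<Gamma>. int (m w u) * int (x w)) = 0"
        using sum_nonneg[of "verts \<Gamma>" "\<lambda>w. int (m w u) * int (x w)"] by simp
      then have "int (m v u) * int (x v) = 0"
        using v finite_verts by (subst (asm) sum_nonneg_eq_0_iff) auto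
      then show "v \<in> W"
        using \<open>0 < m u v\<close> v by (simp add: W_def edge_mult_sym[of v u])
    qed (use \<open>W \<noteq> {}\<close> in \<open>auto simp: W_def\<close>)
    then have "x v = 0" for v
      using topples_outside(1)[OF x, of v] unfolding W_def by blast
    then have "x = (\<lambda>_. 0)"
      by auto
    then have "r v = 0" for v
      using lap[of v] r(1) by (cases "v \<in> V") (auto simp: configs_def)
    then show False
      using r(2) by auto
  qed
  then have pos: "0 < x v" if "v \<in> V" for v
    using that by (auto simp: W_def)
  show ?thesis
    unfolding no_forbidden_def
  proof (intro allI impI)
    fix F assume "F \<subseteq> V" "F \<noteq> {}"
    then show "\<exists>v\<in>F. (\<Sum>u\<in>F. m u v) \<le> c v"
      using topples_no_forbidden[OF x] pos by blast
  qed
qed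

text \<open>The chips that the sink sends out when it topples (Dhar's burning test).\<close>

definition burn :: "'a \<Rightarrow> nat" where
  "burn v = (if v \<in> V then m s v else 0)"

lemma burn_configs: "burn \<in> configs \<Gamma> s"
  by (auto simp: burn_def configs_def)

lemma burn_pos: "v \<in> V \<Longrightarrow> 0 < burn v"
  using sink_adjacent by (simp add: burn_def)

text \<open>When all non-sink vertices topple equally often, only the edges to the sink have a net
  effect. Hence \<open>burn\<close> is trivial modulo the Laplacian.\<close>

lemma laplacian_const:
  assumes "v \<in> V"
  shows "laplacian (\<lambda>v. if v \<in> V then k else 0) v = k * int (burn v)"
  using assms by (simp add: laplacian_def sum_verts burn_def)

text \<open>Toppling everything once would restore the stable \<open>c\<close>, so by least action
  no vertex topples twice. If the set \<open>F\<close> of untoppled vertices were nonempty, a vertex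
  of \<open>F\<close> with as many chips as edges into \<open>F\<close> would end up
  unstable.\<close>

lemma no_forbidden_burn:
  assumes "stable \<Gamma> s c" "no_forbidden c"
  shows "topples (conf_add c burn) (\<lambda>v. if v \<in> V then 1 else 0) c"
proof -
  obtain x where x: "topples (conf_add c burn) x (stabilize \<Gamma> s (conf_add c burn))"
    by (rule stabilize_topples)
  let ?d = "stabilize \<Gamma> s (conf_add c burn)"
  have le1: "int (x v) \<le> 1" if "v \<in> V" for v
  proof -
    have "int (x v) \<le> (if v \<in> V then 1 else 0)"
    proof (rule least_action[OF x _ _ _ that])
      fix v assume "v \<in> V"
      then show "int (conf_add c burn v) - laplacian (\<lambda>v. if v \<in> V then 1 else 0) v < int (degree \<Gamma> v)"
        using assms(1) laplacian_const[of v 1] by (auto simp: stable_def conf_add_def)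
    qed auto
    then show ?thesis using that by simp
  qed
  define F where "F = {v \<in> V. x v = 0}"
  have "F = {}"
  proof (rule ccontr)
    assume "F \<noteq> {}"
    have "F \<subseteq> V"
      by (auto simp: F_def)
    with \<open>F \<noteq> {}\<close> obtain v where v: "v \<in> F" and ample: "(\<Sum>u\<in>F. m u v) \<le> c v"
      using assms(2) unfolding no_forbidden_def by blast
    have vV: "v \<in> V" and "x v = 0" and "x s = 0"
      using v topples_outside(1)[OF x, of s] by (auto simp: F_def)
    have "- laplacian (\<lambda>v. int (x v)) v = (\<Sum>u\<in>verts \<Gamma>. int (m u v) * int (x u))"
      unfolding laplacian_def by (simp add: \<open>x v = 0\<close> sum_negf)
    also have "\<dots> = (\<Sum>u\<in>V. int (m u v) * int (x u))"
      by (simp add: sum_verts \<open>x s = 0\<close>)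
    also have "\<dots> = (\<Sum>u\<in>V - F. int (m u v) * int (x u))"
      by (rule sum.mono_neutral_right) (auto simp: F_def)
    also have "\<dots> = (\<Sum>u\<in>V - F. int (m u v))"
    proof (rule sum.cong)
      fix u assume "u \<in> V - F"
      then have "x u = 1"
        using le1[of u] by (auto simp: F_def)
      then show "int (m u v) * int (x u) = int (m u v)" by simp
    qed simp
    finally have "int (?d v) = int (c v) + int (burn v) + (\<Sum>u\<in>V - F. int (m u v))"
      using topples_balance[OF x vV] by (simp add: conf_add_def)
    also have "\<dots> \<ge> (\<Sum>u\<in>F. int (m u v)) + int (burn v) + (\<Sum>u\<in>V - F. int (m u v))"
      using ample by (simp flip: of_nat_sum)
    also have "(\<Sum>u\<in>F. int (m u v)) + int (burn v) + (\<Sum>u\<in>V - F. int (m u v))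
        = int (burn v) + (\<Sum>u\<in>V. int (m u v))"
      using sum.subset_diff[OF \<open>F \<subseteq> V\<close> finite_V, of "\<lambda>u. int (m u v)"] by simp
    \<comment> \<open>The degree splits into the edges to the sink, matched by
      \<open>burn v\<close>, those to \<open>V - F\<close>, whose ends toppled once, and those to
      \<open>F\<close>, matched by the chips of \<open>c\<close> on \<open>v\<close>.\<close>
    also have "\<dots> = int (degree \<Gamma> v)"
      using vV by (simp add: degree_def sum_verts burn_def edge_mult_sym[of v])
    finally have "degree \<Gamma> v \<le> ?d v"
      by simp
    moreover have "?d v < degree \<Gamma> v"
      using stable_stabilize vV unfolding stable_def by blast
    ultimately show False by simp
  qed
  have "x v = (if v \<in> V then 1 else 0)" for v
  proof (cases "v \<in> V")
    case True
    then show ?thesis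
      using le1[OF True] \<open>F = {}\<close> unfolding F_def by (cases "x v") auto
  next
    case False
    then show ?thesis
      using topples_outside(1)[OF x False] by simp
  qed
  then have x_eq: "x = (\<lambda>v. if v \<in> V then 1 else 0)"
    by (rule ext)
  have "?d v = c v" for v
  proof (cases "v \<in> V")
    case True
    have "(\<lambda>v. int (x v)) = (\<lambda>v. if v \<in> V then 1 else 0)"
      by (auto simp: x_eq)
    then show ?thesis
      using topples_balance[OF x True] laplacian_const[OF True, of 1] by (simp add: conf_add_def)
  next
    case False
    then have "conf_add c burn v = c v"
      by (auto simp: conf_add_def burn_def)
    then show ?thesis
      using topples_outside(2)[OF x False] by simp
  qed
  then have "?d = c"
    by (rule ext)
  then show ?thesis
    using x x_eq by simp
qed

lemma recurrentI:
  assumes "r \<in> configs \<Gamma> s" "r \<noteq> (\<lambda>_. 0)" "c \<in> configs \<Gamma> s" "stabilize \<Gamma> s (conf_add c r) = c"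
  shows "recurrent \<Gamma> s c"
  using assms stable_stabilize[of "conf_add c r"] by (auto simp: recurrent_def)

lemma burn_nonzero: "burn \<noteq> (\<lambda>_. 0)"
proof -
  obtain v where "v \<in> V"
    using nonsink_nonempty by blast
  then show ?thesis
    using burn_pos[of v] by (auto dest: fun_cong)
qed

text \<open>For the converse direction \<open>burn\<close> serves as the configuration
  \<open>r\<close> in the definition of recurrence.\<close>

theorem recurrent_iff_no_forbidden:
  "recurrent \<Gamma> s c \<longleftrightarrow> c \<in> configs \<Gamma> s \<and> stable \<Gamma> s c \<and> no_forbidden c"
proof
  assume "recurrent \<Gamma> s c"
  then show "c \<in> configs \<Gamma> s \<and> stable \<Gamma> s c \<and> no_forbidden c"
    using recurrent_no_forbidden by (auto simp: recurrent_def)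
next
  assume "c \<in> configs \<Gamma> s \<and> stable \<Gamma> s c \<and> no_forbidden c"
  then show "recurrent \<Gamma> s c"
    using recurrentI[OF burn_configs burn_nonzero] stabilize_eqI[OF no_forbidden_burn] by blast
qed

section \<open>Uniqueness of the recurrent configuration in a class modulo the Laplacian\<close>

lemma recurrent_burn:
  assumes "recurrent \<Gamma> s c"
  shows "topples (\<lambda>v. c v + k * burn v) (\<lambda>v. if v \<in> V then k else 0) c"
proof (induction k)
  case 0
  show ?case
    using topples.refl[of c] by (simp cong: if_cong)
next
  case (Suc k)
  \<comment> \<open>The first \<open>k\<close> copies burn off in the presence of the last one,
    which then burns off alone.\<close>
  have "topples (conf_add (\<lambda>v. c v + k * burn v) burn) (\<lambda>v. if v \<in> V then k else 0) (conf_add c burn)"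
    using topples_add[OF Suc] .
  moreover have "topples (conf_add c burn) (\<lambda>v. if v \<in> V then 1 else 0) c"
    using assms by (intro no_forbidden_burn) (auto simp: recurrent_iff_no_forbidden)
  ultimately have "topples (conf_add (\<lambda>v. c v + k * burn v) burn)
      (\<lambda>v. (if v \<in> V then k else 0) + (if v \<in> V then 1 else 0)) c"
    by (rule topples_trans[rotated])
  moreover have "conf_add (\<lambda>v. c v + k * burn v) burn = (\<lambda>v. c v + Suc k * burn v)"
    by (auto simp: conf_add_def)
  moreover have "(\<lambda>v. (if v \<in> V then k else 0) + (if v \<in> V then 1 else 0)) = (\<lambda>v. if v \<in> V then Suc k else 0)"
    by auto
  ultimately show ?case
    by (simp only:)
qed

text \<open>Adding \<open>k\<close> times \<open>burn\<close> to \<open>c\<close> makes every vertex topple \<open>k\<close> times, whereas \<open>k + z\<close> topplings would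
  already reach the stable \<open>d\<close>; the least action principle then yields \<open>k \<le> k + z\<close>.\<close>

lemma recurrent_script_nonneg:
  assumes "recurrent \<Gamma> s c" "stable \<Gamma> s d" "z s = 0"
    and cd: "\<And>v. v \<in> V \<Longrightarrow> int (d v) = int (c v) - laplacian z v"
    and "v \<in> V"
  shows "0 \<le> z v"
proof -
  \<comment> \<open>A bound for all \<open>\<bar>z v\<bar>\<close>, so that \<open>k + z\<close> is
    nonnegative on \<open>V\<close>, as the least action principle requires.\<close>
  define k where "k = nat (\<Sum>v\<in>V. \<bar>z v\<bar>)"
  have k: "\<bar>z v\<bar> \<le> int k" if "v \<in> V" for v
    using member_le_sum[of v V "\<lambda>v. \<bar>z v\<bar>"] that by (simp add: k_def)
  have "int (if v \<in> V then k else 0) \<le> (if v \<in> V then int k else 0) + z v"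
  proof (rule least_action[OF recurrent_burn[OF assms(1)] _ _ _ \<open>v \<in> V\<close>])
    fix v assume v: "v \<in> V"
    show "0 \<le> (if v \<in> V then int k else 0) + z v"
      using k[OF v] v by auto
    have "int (d v) < int (degree \<Gamma> v)"
      using assms(2) v by (simp add: stable_def)
    then show "int (c v + k * burn v) - laplacian (\<lambda>v. (if v \<in> V then int k else 0) + z v) v
        < int (degree \<Gamma> v)"
      using cd[OF v] v by (simp add: laplacian_add laplacian_const del: Diff_iff)
  qed (simp add: assms(3))
  then show ?thesis
    using \<open>v \<in> V\<close> by simp
qed

text \<open>The script \<open>z\<close> from \<open>c\<close> to \<open>d\<close> and the script
  \<open>- z\<close> from \<open>d\<close> to \<open>c\<close> are both nonnegative, so
  \<open>z\<close> vanishes.\<close>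

theorem recurrent_unique:
  assumes "recurrent \<Gamma> s c" "recurrent \<Gamma> s d" "z s = 0"
    and cd: "\<And>v. v \<in> V \<Longrightarrow> int (d v) = int (c v) - laplacian z v"
  shows "c = d"
proof -
  have stab: "stable \<Gamma> s c" "stable \<Gamma> s d"
    using assms(1,2) by (auto simp: recurrent_def)
  have z0: "z v = 0" if "v \<in> verts \<Gamma>" for v
  proof (cases "v = s")
    case False
    have "0 \<le> z v"
      using recurrent_script_nonneg[OF assms(1) stab(2) assms(3) cd] that False by blast
    moreover have "0 \<le> - z v"
      by (rule recurrent_script_nonneg[OF assms(2) stab(1)])
        (use that False assms(3) cd in \<open>auto simp: laplacian_uminus\<close>)
    ultimately show ?thesis by simp
  qed (simp add: assms(3))
  show ?thesis
  proof
    fix v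
    show "c v = d v"
      using assms(1,2) cd[of v] z0
      by (cases "v \<in> V") (auto simp: laplacian_def recurrent_def configs_def)
  qed
qed

section \<open>The group structure\<close>

text \<open>A witness \<open>r\<close> for \<open>c\<close> also works for
  \<open>c \<oplus> d\<close>, since adding \<open>r\<close> can be carried out on \<open>c\<close>
  first.\<close>

lemma recurrent_op:
  assumes "recurrent \<Gamma> s c" "d \<in> configs \<Gamma> s"
  shows "recurrent \<Gamma> s (sandpile_op \<Gamma> s c d)"
proof -
  obtain r where r: "r \<in> configs \<Gamma> s" "r \<noteq> (\<lambda>_. 0)" "stabilize \<Gamma> s (conf_add c r) = c"
    using assms by (auto simp: recurrent_def)
  have "stabilize \<Gamma> s (conf_add (sandpile_op \<Gamma> s c d) r) = sandpile_op \<Gamma> s c d"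
    using r(3) sandpile_op_assoc sandpile_op_commute by (metis sandpile_op_def)
  with r(1,2) show ?thesis
    using assms by (intro recurrentI) (auto simp: recurrent_def sandpile_op_def
      intro: stabilize_configs conf_add_configs)
qed

section \<open>Existence of a recurrent configuration in every class\<close>

lemma finite_stable: "finite {c \<in> configs \<Gamma> s. stable \<Gamma> s c}"
proof (rule finite_subset)
  \<comment> \<open>The sum of all degrees is a common bound for all vertices;
    \<open>finite_set_of_finite_funs\<close> takes a single finite range.\<close>
  show "{c \<in> configs \<Gamma> s. stable \<Gamma> s c}
      \<subseteq> {c. \<forall>v. (v \<in> V \<longrightarrow> c v \<in> {..(\<Sum>u\<in>V. degree \<Gamma> u)}) \<and> (v \<notin> V \<longrightarrow> c v = 0)}"
  proof (intro subsetI CollectI allI conjI impI)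
    fix c v assume c: "c \<in> {c \<in> configs \<Gamma> s. stable \<Gamma> s c}"
    {
      assume v: "v \<in> V"
      then have "c v \<le> degree \<Gamma> v"
        using c by (auto simp: stable_def intro: less_imp_le)
      also have "\<dots> \<le> (\<Sum>u\<in>V. degree \<Gamma> u)"
        using v by (intro member_le_sum) auto
      finally show "c v \<in> {..(\<Sum>u\<in>V. degree \<Gamma> u)}" by simp
    next
      assume "v \<notin> V"
      then show "c v = 0"
        using c by (auto simp: configs_def)
    }
  qed
  show "finite {c. \<forall>v. (v \<in> V \<longrightarrow> c v \<in> {..(\<Sum>u\<in>V. degree \<Gamma> u)}) \<and> (v \<notin> V \<longrightarrow> c v = (0::nat))}"
    by (rule finite_set_of_finite_funs) auto
qed

text \<open>The configurations \<open>stabilize \<Gamma> s (c + k * burn)\<close> all lie in the class of \<open>c\<close>; one that is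
  repeated is recurrent.\<close>

lemma ex_recurrent:
  assumes c: "c \<in> configs \<Gamma> s"
  obtains d z where "recurrent \<Gamma> s d" "z s = 0"
    "\<And>v. v \<in> V \<Longrightarrow> int (d v) = int (c v) - laplacian z v"
proof -
  define q where "q k = stabilize \<Gamma> s (\<lambda>v. c v + k * burn v)" for k
  have conf: "(\<lambda>v. c v + k * burn v) \<in> configs \<Gamma> s" for k
    using c burn_configs by (auto simp: configs_def)
  have "range q \<subseteq> {c \<in> configs \<Gamma> s. stable \<Gamma> s c}"
    using stabilize_configs[OF conf] stable_stabilize by (auto simp: q_def)
  then have "\<not> inj q"
    using finite_stable finite_subset finite_imageD infinite_UNIV_nat by blast
  then obtain i j where ij: "i < j" "q i = q j"
    by (auto simp: inj_on_def) (metis linorder_neqE_nat)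
  \<comment> \<open>The multiple of \<open>burn\<close> by which the inputs of \<open>q i\<close>
    and \<open>q j\<close> differ; adding it to \<open>q i\<close> leads to
    \<open>q j = q i\<close>.\<close>
  define r where "r = (\<lambda>v. (j - i) * burn v)"
  have "recurrent \<Gamma> s (q i)"
  proof (rule recurrentI)
    show "r \<in> configs \<Gamma> s"
      using burn_configs by (auto simp: r_def configs_def)
    show "r \<noteq> (\<lambda>_. 0)"
      using burn_nonzero ij(1) by (auto simp: r_def fun_eq_iff)
    show "q i \<in> configs \<Gamma> s"
      unfolding q_def by (rule stabilize_configs[OF conf])
    have "conf_add (\<lambda>v. c v + i * burn v) r = (\<lambda>v. c v + j * burn v)"
    proof
      fix v
      have "i * burn v + (j - i) * burn v = j * burn v"
        using ij(1) by (simp flip: add_mult_distrib)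
      then show "conf_add (\<lambda>v. c v + i * burn v) r v = c v + j * burn v"
        by (simp add: conf_add_def r_def)
    qed
    then show "stabilize \<Gamma> s (conf_add (q i) r) = q i"
      unfolding ij(2) by (metis ij(2) q_def stabilize_add_stabilize)
  qed
  moreover obtain x where x: "topples (\<lambda>v. c v + i * burn v) x (q i)"
    unfolding q_def by (rule stabilize_topples)
  \<comment> \<open>Subtracting \<open>i\<close> topplings of every vertex cancels the
    \<open>i * burn\<close> that was added to \<open>c\<close>.\<close>
  define z where "z v = int (x v) - (if v \<in> V then int i else 0)" for v
  have "z s = 0"
    using topples_outside(1)[OF x, of s] by (simp add: z_def)
  moreover have "int (q i v) = int (c v) - laplacian z v" if "v \<in> V" for v
    using topples_balance[OF x that]
    by (simp add: z_def[abs_def] laplacian_diff laplacian_const[OF that] del: Diff_iff)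
  ultimately show thesis
    by (rule that)
qed

section \<open>The operation as addition of classes; identity and inverses\<close>

lemma sandpile_op_balance:
  obtains x where "x s = 0"
    "\<And>v. v \<in> V \<Longrightarrow> int (sandpile_op \<Gamma> s c d v) = int (c v) + int (d v) - laplacian x v"
proof -
  obtain x where x: "topples (conf_add c d) x (sandpile_op \<Gamma> s c d)"
    unfolding sandpile_op_def by (rule stabilize_topples)
  show thesis
  proof (rule that)
    show "int (x s) = 0"
      using topples_outside(1)[OF x, of s] by simp
    fix v assume "v \<in> V"
    then show "int (sandpile_op \<Gamma> s c d v) = int (c v) + int (d v) - laplacian (\<lambda>v. int (x v)) v"
      using topples_balance[OF x] by (simp add: conf_add_def)
  qed
qed

text \<open>Equations in the group can thus be checked modulo the Laplacian, by exhibiting any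
  integer script; uniqueness of recurrent representatives does the rest.\<close>

lemma sandpile_op_eqI:
  assumes "recurrent \<Gamma> s c" "recurrent \<Gamma> s d" "recurrent \<Gamma> s e" "z s = 0"
    and "\<And>v. v \<in> V \<Longrightarrow> int (e v) = int (c v) + int (d v) - laplacian z v"
  shows "sandpile_op \<Gamma> s c d = e"
proof -
  obtain x where x: "x s = 0"
    "\<And>v. v \<in> V \<Longrightarrow> int (sandpile_op \<Gamma> s c d v) = int (c v) + int (d v) - laplacian x v"
    by (rule sandpile_op_balance[of c d]) blast
  show ?thesis
  proof (rule recurrent_unique)
    show "recurrent \<Gamma> s (sandpile_op \<Gamma> s c d)"
      using assms(1,2) by (intro recurrent_op) (auto simp: recurrent_def)
    show "z s - x s = 0"
      using x(1) assms(4) by simp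
    show "int (e v) = int (sandpile_op \<Gamma> s c d v) - laplacian (\<lambda>v. z v - x v) v" if "v \<in> V" for v
      using x(2)[OF that] assms(5)[OF that] by (simp add: laplacian_diff)
  qed (rule assms(3))
qed

text \<open>The identity is the recurrent representative of the class of the zero configuration. Two
  neutral elements coincide, so the definite description denotes it.\<close>

lemma sandpile_identity:
  shows recurrent_identity: "recurrent \<Gamma> s (sandpile_identity \<Gamma> s)"
    and sandpile_op_identity:
      "recurrent \<Gamma> s c \<Longrightarrow> sandpile_op \<Gamma> s (sandpile_identity \<Gamma> s) c = c"
    and identity_balance: "\<exists>z. z s = 0 \<and> (\<forall>v\<in>V. int (sandpile_identity \<Gamma> s v) = - laplacian z v)"
proof -
  have "(\<lambda>_. 0) \<in> configs \<Gamma> s"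
    by (simp add: configs_def)
  then obtain e z where e: "recurrent \<Gamma> s e" and z: "z s = 0"
    "\<And>v. v \<in> V \<Longrightarrow> int (e v) = int 0 - laplacian z v"
    by (rule ex_recurrent) blast
  have neutral: "sandpile_op \<Gamma> s e c = c" if "recurrent \<Gamma> s c" for c
    by (rule sandpile_op_eqI[OF e that that, of "\<lambda>v. - z v"])
      (use z in \<open>auto simp: laplacian_uminus\<close>)
  have "sandpile_identity \<Gamma> s = e"
    unfolding sandpile_identity_def
  proof (rule the_equality)
    show "recurrent \<Gamma> s e \<and>
        (\<forall>c. recurrent \<Gamma> s c \<longrightarrow> sandpile_op \<Gamma> s e c = c \<and> sandpile_op \<Gamma> s c e = c)"
      using e neutral sandpile_op_commute by metis
  qed (metis e neutral)
  then show "recurrent \<Gamma> s (sandpile_identity \<Gamma> s)"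
    "recurrent \<Gamma> s c \<Longrightarrow> sandpile_op \<Gamma> s (sandpile_identity \<Gamma> s) c = c"
    "\<exists>z. z s = 0 \<and> (\<forall>v\<in>V. int (sandpile_identity \<Gamma> s v) = - laplacian z v)"
    using e neutral z by auto
qed

text \<open>Multiples of \<open>burn\<close> are trivial in the group and positive on \<open>V\<close>, so the class of \<open>- c\<close> contains a
  configuration.\<close>

lemma ex_inverse:
  assumes "recurrent \<Gamma> s c"
  shows "\<exists>d. recurrent \<Gamma> s d \<and> sandpile_op \<Gamma> s d c = sandpile_identity \<Gamma> s"
proof -
  \<comment> \<open>The total number of chips bounds each \<open>c v\<close>, and
    \<open>burn\<close> is at least 1 on \<open>V\<close>; so the truncated subtraction in
    \<open>n\<close> is exact there.\<close>
  define k where "k = (\<Sum>v\<in>V. c v)"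
  define n where "n v = k * burn v - c v" for v
  have n: "int (n v) = int k * int (burn v) - int (c v)" if "v \<in> V" for v
  proof -
    have "c v \<le> k"
      using that by (auto simp: k_def intro: member_le_sum)
    also have "k \<le> k * burn v"
      using burn_pos[OF that] by simp
    finally show ?thesis
      by (simp add: n_def)
  qed
  have "n \<in> configs \<Gamma> s"
    using assms burn_configs by (auto simp: n_def configs_def recurrent_def)
  then obtain d z where d: "recurrent \<Gamma> s d" and z: "z s = 0"
    "\<And>v. v \<in> V \<Longrightarrow> int (d v) = int (n v) - laplacian z v"
    by (rule ex_recurrent) blast
  obtain y where y: "y s = 0" "\<And>v. v \<in> V \<Longrightarrow> int (sandpile_identity \<Gamma> s v) = - laplacian y v"
    using identity_balance by blast
  \<comment> \<open>In the script, the constant \<open>k\<close> removes \<open>k * burn\<close>,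
    \<open>- z\<close> undoes the passage from \<open>n\<close> to \<open>d\<close>, and
    \<open>y\<close> leads from zero to the identity.\<close>
  have "sandpile_op \<Gamma> s d c = sandpile_identity \<Gamma> s"
  proof (rule sandpile_op_eqI[OF d assms recurrent_identity,
        where z = "\<lambda>v. (if v \<in> V then int k else 0) - z v + y v"])
    show "(if s \<in> V then int k else 0) - z s + y s = 0"
      using z(1) y(1) by simp
    show "int (sandpile_identity \<Gamma> s v)
        = int (d v) + int (c v) - laplacian (\<lambda>v. (if v \<in> V then int k else 0) - z v + y v) v"
      if "v \<in> V" for v
      using y(2)[OF that] z(2)[OF that] n[OF that] laplacian_const[OF that, of "int k"]
      by (simp add: laplacian_diff laplacian_add del: Diff_iff)
  qed
  with d show ?thesis by blast
qed

theorem group_sandpile_group: "group (sandpile_group \<Gamma> s)"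
proof (rule groupI)
  fix c d assume "c \<in> carrier (sandpile_group \<Gamma> s)" "d \<in> carrier (sandpile_group \<Gamma> s)"
  then have "recurrent \<Gamma> s c" "recurrent \<Gamma> s d"
    by (simp_all add: sandpile_group_def)
  moreover from this(2) have "d \<in> configs \<Gamma> s"
    by (simp add: recurrent_def)
  ultimately show "c \<otimes>\<^bsub>sandpile_group \<Gamma> s\<^esub> d \<in> carrier (sandpile_group \<Gamma> s)"
    by (simp add: sandpile_group_def recurrent_op)
qed (simp_all add: sandpile_group_def recurrent_identity sandpile_op_identity sandpile_op_assoc
    ex_inverse)

end

section \<open>Cones\<close>

lemma nonsink_cone: "verts (cone G) - {cone_sink} = Some ` verts G"
  by (auto simp: cone_def)

lemma edge_mult_cone: "edge_mult (cone G) = cone_mult G"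
  by (simp add: cone_def)

lemma finite_multigraph_cone:
  assumes "finite_multigraph G"
  shows "finite_multigraph (cone G)"
proof -
  interpret finite_multigraph G by fact
  have "cone_mult G x y = cone_mult G y x" for x y
    by (cases x; cases y) (auto simp: edge_mult_sym)
  moreover have "cone_mult G x y = 0" if "x \<notin> insert None (Some ` verts G)" for x y
  proof (cases x)
    case (Some u)
    then have "u \<notin> verts G"
      using that by auto
    with Some show ?thesis
      by (cases y) (auto simp: edge_mult_outside)
  qed (use that in simp)
  ultimately show ?thesis
    using finite_verts by unfold_locales (auto simp: cone_def)
qed

text \<open>Membership in \<open>W\<close> propagates along paths; this yields the closed-set form
  of connectedness assumed in \<open>sandpile\<close>.\<close>

lemma connected_closed_set:
  assumes "connected_multigraph G" "W \<subseteq> verts G" "W \<noteq> {}"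
    and closed: "\<And>u v. u \<in> W \<Longrightarrow> v \<in> verts G \<Longrightarrow> 0 < edge_mult G u v \<Longrightarrow> v \<in> W"
  shows "W = verts G"
proof
  obtain w where w: "w \<in> W"
    using assms(3) by blast
  show "verts G \<subseteq> W"
  proof
    fix v assume "v \<in> verts G"
    then have "(adjacent G)\<^sup>*\<^sup>* w v"
      using assms(1,2) w by (auto simp: connected_multigraph_def)
    then show "v \<in> W"
      by induction (use w closed in \<open>auto simp: adjacent_def\<close>)
  qed
qed fact

lemma sandpile_cone:
  assumes "finite_multigraph G" "loopless G" "connected_multigraph G"
  shows "sandpile (cone G) cone_sink"
proof -
  interpret finite_multigraph G by fact
  interpret cone: finite_multigraph "cone G"
    by (rule finite_multigraph_cone) fact
  show ?thesis
  proof
    show "cone_sink \<in> verts (cone G)"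
      by (simp add: cone_def)
    show "edge_mult (cone G) v v = 0" for v
      using assms(2) edge_mult_outside
      by (cases v) (auto simp: edge_mult_cone loopless_def)
    show "0 < edge_mult (cone G) cone_sink v" if "v \<in> verts (cone G) - {cone_sink}" for v
      using that unfolding nonsink_cone by (auto simp: edge_mult_cone)
    show "verts (cone G) - {cone_sink} \<noteq> {}"
      unfolding nonsink_cone using assms(3) by (simp add: connected_multigraph_def)
    show "W = verts (cone G) - {cone_sink}"
      if W: "W \<subseteq> verts (cone G) - {cone_sink}" "W \<noteq> {}"
        and closed: "\<And>u v. u \<in> W \<Longrightarrow> v \<in> verts (cone G) - {cone_sink} \<Longrightarrow>
          0 < edge_mult (cone G) u v \<Longrightarrow> v \<in> W" for W
    proof -
      obtain W' where W': "W' \<subseteq> verts G" "W = Some ` W'"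
        using W(1) unfolding nonsink_cone by (auto simp: subset_image_iff)
      have "W' = verts G"
      proof (rule connected_closed_set[OF assms(3) W'(1)])
        show "v \<in> W'" if "u \<in> W'" "v \<in> verts G" "0 < edge_mult G u v" for u v
          using closed[of "Some u" "Some v"] that unfolding nonsink_cone
          by (auto simp: edge_mult_cone W'(2))
      qed (use W(2) W'(2) in auto)
      then show ?thesis
        unfolding nonsink_cone W'(2) by simp
    qed
  qed
qed

lemma sum_verts_cone:
  fixes f :: "'a option \<Rightarrow> 'c::comm_monoid_add"
  assumes "finite_multigraph G"
  shows "(\<Sum>w\<in>verts (cone G). f w) = f None + (\<Sum>u\<in>verts G. f (Some u))"
  using assms finite_multigraph.finite_verts[OF assms]
  by (simp add: cone_def sum.reindex image_iff)

lemma degree_cone: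
  assumes "finite_multigraph G" "u \<in> verts G"
  shows "degree (cone G) (Some u) = Suc (degree G u)"
  using assms(2) by (simp add: degree_def edge_mult_cone sum_verts_cone[OF assms(1)])

text \<open>The edge to the sink raises the degree by one, which makes the strict bound weak. Weak
  bounds add up, hence boxes of stable configurations are stable.\<close>

lemma stable_cone:
  assumes "finite_multigraph G"
  shows "stable (cone G) cone_sink c \<longleftrightarrow> (\<forall>u\<in>verts G. c (Some u) \<le> degree G u)"
  unfolding stable_def nonsink_cone by (auto simp: degree_cone[OF assms] less_Suc_eq_le)

lemma laplacian_cone:
  assumes "sandpile (cone G) cone_sink" "finite_multigraph G" "u \<in> verts G" "z cone_sink = 0"
  shows "sandpile.laplacian (cone G) z (Some u)
    = z (Some u) + (\<Sum>u'\<in>verts G. int (edge_mult G u' u) * (z (Some u) - z (Some u')))"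
  using assms(3,4)
  by (simp add: sandpile.laplacian_def[OF assms(1)] edge_mult_cone sum_verts_cone[OF assms(2)])

lemma no_forbidden_cone:
  assumes "sandpile (cone G) cone_sink"
  shows "sandpile.no_forbidden (cone G) cone_sink c \<longleftrightarrow>
    (\<forall>F\<subseteq>verts G. F \<noteq> {} \<longrightarrow> (\<exists>v\<in>F. (\<Sum>u\<in>F. edge_mult G u v) \<le> c (Some v)))"
  unfolding sandpile.no_forbidden_def[OF assms] nonsink_cone
  by (simp add: all_subset_image sum.reindex edge_mult_cone)

section \<open>Cartesian products\<close>

lemma verts_cart_prod [simp]: "verts (cart_prod G H) = verts G \<times> verts H"
  by (simp add: cart_prod_def)

text \<open>Edges at \<open>(u, v)\<close> stay in its row or its column. Weight and semiring are
  general so that the identity serves degrees, Laplacians and edge counts within a subset.\<close>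

lemma sum_cart_prod:
  fixes f :: "'a \<times> 'b \<Rightarrow> 'c::comm_semiring_1"
  assumes "finite_multigraph G" "finite_multigraph H" "u \<in> verts G" "v \<in> verts H"
  shows "(\<Sum>w\<in>verts G \<times> verts H. of_nat (edge_mult (cart_prod G H) w (u, v)) * f w)
    = (\<Sum>u'\<in>verts G. of_nat (edge_mult G u' u) * f (u', v))
      + (\<Sum>v'\<in>verts H. of_nat (edge_mult H v' v) * f (u, v'))"
proof -
  have fin: "finite (verts G)" "finite (verts H)"
    using assms(1,2) by (auto dest: finite_multigraph.finite_verts)
  have "(\<Sum>w\<in>verts G \<times> verts H. of_nat (edge_mult (cart_prod G H) w (u, v)) * f w)
    = (\<Sum>u'\<in>verts G. \<Sum>v'\<in>verts H.
        (if u' = u then of_nat (edge_mult H v' v) * f (u, v') else 0)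
        + (if v' = v then of_nat (edge_mult G u' u) * f (u', v) else 0))"
    unfolding sum.cartesian_product
    by (rule sum.cong) (use assms(3,4) in \<open>auto simp: cart_prod_def algebra_simps\<close>)
  also have "\<dots> = (\<Sum>v'\<in>verts H. \<Sum>u'\<in>verts G.
        if u' = u then of_nat (edge_mult H v' v) * f (u, v') else 0)
      + (\<Sum>u'\<in>verts G. \<Sum>v'\<in>verts H. if v' = v then of_nat (edge_mult G u' u) * f (u', v) else 0)"
    by (simp add: sum.distrib sum.swap[of _ "verts G"])
  also have "\<dots> = (\<Sum>v'\<in>verts H. of_nat (edge_mult H v' v) * f (u, v'))
      + (\<Sum>u'\<in>verts G. of_nat (edge_mult G u' u) * f (u', v))"
    using assms(3,4) fin by simp
  finally show ?thesis
    by (simp add: add.commute)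
qed

lemma finite_multigraph_cart_prod:
  assumes "finite_multigraph G" "finite_multigraph H"
  shows "finite_multigraph (cart_prod G H)"
proof -
  interpret G: finite_multigraph G by fact
  interpret H: finite_multigraph H by fact
  show ?thesis
  proof
    show "finite (verts (cart_prod G H))"
      using G.finite_verts H.finite_verts by simp
    show "edge_mult (cart_prod G H) x y = edge_mult (cart_prod G H) y x" for x y
      by (auto simp: cart_prod_def G.edge_mult_sym H.edge_mult_sym split: prod.split)
    show "edge_mult (cart_prod G H) x y = 0" if "x \<notin> verts (cart_prod G H)" for x y
      using that G.edge_mult_outside H.edge_mult_outside G.edge_mult_sym H.edge_mult_sym
      by (cases x; cases y) (auto simp: cart_prod_def)
  qed
qed

lemma loopless_cart_prod: "loopless G \<Longrightarrow> loopless H \<Longrightarrow> loopless (cart_prod G H)"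
  by (auto simp: loopless_def cart_prod_def)

lemma connected_cart_prod:
  assumes "connected_multigraph G" "connected_multigraph H"
  shows "connected_multigraph (cart_prod G H)"
proof -
  have fiber_H: "(adjacent (cart_prod G H))\<^sup>*\<^sup>* (u, v) (u, v')"
    if "(adjacent H)\<^sup>*\<^sup>* v v'" "u \<in> verts G" for u v v'
    using that(1)
  proof induction
    case (step y z)
    then have "adjacent (cart_prod G H) (u, y) (u, z)"
      using that(2) by (simp add: adjacent_def cart_prod_def)
    with step.IH show ?case
      by (meson rtranclp.rtrancl_into_rtrancl)
  qed simp
  have fiber_G: "(adjacent (cart_prod G H))\<^sup>*\<^sup>* (u, v) (u', v)"
    if "(adjacent G)\<^sup>*\<^sup>* u u'" "v \<in> verts H" for u u' v
    using that(1)
  proof induction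
    case (step y z)
    then have "adjacent (cart_prod G H) (y, v) (z, v)"
      using that(2) by (simp add: adjacent_def cart_prod_def)
    with step.IH show ?case
      by (meson rtranclp.rtrancl_into_rtrancl)
  qed simp
  show ?thesis
    unfolding connected_multigraph_def
  proof (intro conjI ballI)
    show "verts (cart_prod G H) \<noteq> {}"
      using assms by (simp add: connected_multigraph_def)
    fix x y assume "x \<in> verts (cart_prod G H)" "y \<in> verts (cart_prod G H)"
    then obtain u v u' v' where xy: "x = (u, v)" "y = (u', v')"
      and mem: "u \<in> verts G" "u' \<in> verts G" "v \<in> verts H" "v' \<in> verts H"
      by auto
    have "(adjacent (cart_prod G H))\<^sup>*\<^sup>* (u, v) (u, v')"
      using assms(2) mem by (intro fiber_H) (auto simp: connected_multigraph_def)
    also have "(adjacent (cart_prod G H))\<^sup>*\<^sup>* (u, v') (u', v')"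
      using assms(1) mem by (intro fiber_G) (auto simp: connected_multigraph_def)
    finally show "(adjacent (cart_prod G H))\<^sup>*\<^sup>* x y"
      by (simp add: xy)
  qed
qed

lemma degree_cart_prod:
  assumes "finite_multigraph G" "finite_multigraph H" "u \<in> verts G" "v \<in> verts H"
  shows "degree (cart_prod G H) (u, v) = degree G u + degree H v"
  using sum_cart_prod[OF assms, of "\<lambda>_. 1 :: nat"]
  by (simp add: degree_def finite_multigraph.edge_mult_sym[OF finite_multigraph_cart_prod[OF assms(1,2)], of "(u, v)"]
      finite_multigraph.edge_mult_sym[OF assms(1), of u] finite_multigraph.edge_mult_sym[OF assms(2), of v])

lemma box_conf_Some [simp]:
  "u \<in> verts G \<Longrightarrow> v \<in> verts H \<Longrightarrow> box_conf G H a b (Some (u, v)) = a (Some u) + b (Some v)"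
  by (simp add: box_conf_def)

lemma box_conf_configs: "box_conf G H a b \<in> configs (cone (cart_prod G H)) cone_sink"
  unfolding configs_def nonsink_cone by (auto simp: box_conf_def split: option.split)

text \<open>Along a fixed \<open>v\<close> the box is \<open>a\<close> shifted by a constant, so
  \<open>a\<close> can be read off; a nonempty \<open>H\<close> provides such a
  \<open>v\<close>.\<close>

lemma inj_on_box_conf:
  assumes "verts H \<noteq> {}"
  shows "inj_on (\<lambda>a. box_conf G H a b) (configs (cone G) cone_sink)"
proof (rule inj_onI, rule ext)
  fix a a' w
  assume a: "a \<in> configs (cone G) cone_sink" "a' \<in> configs (cone G) cone_sink"
    and eq: "box_conf G H a b = box_conf G H a' b"
  obtain v where v: "v \<in> verts H"
    using assms by blast
  show "a w = a' w"
  proof (cases "w \<in> Some ` verts G")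
    case True
    then obtain u where "u \<in> verts G" "w = Some u" by blast
    then show ?thesis
      using fun_cong[OF eq, of "Some (u, v)"] v by simp
  next
    case False
    then show ?thesis
      using a unfolding configs_def nonsink_cone by simp
  qed
qed

section \<open>Boxes of configurations: Laplacian, recurrence and group operation\<close>

locale sandpile_cone_prod =
  fixes G :: "'a multigraph" and H :: "'b multigraph"
  assumes G: "finite_multigraph G" "loopless G" "connected_multigraph G"
    and H: "finite_multigraph H" "loopless H" "connected_multigraph H"
begin

sublocale G: sandpile "cone G" cone_sink
  by (rule sandpile_cone[OF G])

sublocale H: sandpile "cone H" cone_sink
  by (rule sandpile_cone[OF H])

sublocale GH: sandpile "cone (cart_prod G H)" cone_sink
  by (intro sandpile_cone finite_multigraph_cart_prod loopless_cart_prod connected_cart_prod G H)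

text \<open>Edges in the direction of \<open>G\<close> see only differences of \<open>x\<close>,
  those in the direction of \<open>H\<close> only differences of \<open>y\<close>, and the edge to
  the sink contributes the script's own value, which is already a sum.\<close>

lemma laplacian_box:
  assumes "x cone_sink = 0" "y cone_sink = 0" "u \<in> verts G" "v \<in> verts H"
  shows "GH.laplacian (case_option 0 (\<lambda>(u, v). x (Some u) + y (Some v))) (Some (u, v))
    = G.laplacian x (Some u) + H.laplacian y (Some v)"
  using assms
  by (simp add: laplacian_cone[OF GH.sandpile_axioms finite_multigraph_cart_prod[OF G(1) H(1)]]
      laplacian_cone[OF G.sandpile_axioms G(1)] laplacian_cone[OF H.sandpile_axioms H(1)]
      sum_cart_prod[OF G(1) H(1)])

lemma no_forbidden_box:
  assumes "G.no_forbidden a" "H.no_forbidden b"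
  shows "GH.no_forbidden (box_conf G H a b)"
  unfolding no_forbidden_cone[OF GH.sandpile_axioms] verts_cart_prod
proof (intro allI impI)
  fix F assume F: "F \<subseteq> verts G \<times> verts H" "F \<noteq> {}"
  have fin: "finite (verts G)" "finite (verts H)"
    using G(1) H(1) by (auto dest: finite_multigraph.finite_verts)
  have "fst ` F \<subseteq> verts G" "fst ` F \<noteq> {}"
    using F by auto
  then obtain u where u: "u \<in> fst ` F" and ua: "(\<Sum>u'\<in>fst ` F. edge_mult G u' u) \<le> a (Some u)"
    using assms(1) unfolding no_forbidden_cone[OF G.sandpile_axioms] by meson
  define F\<^sub>u where "F\<^sub>u = {v. (u, v) \<in> F}"
  have "F\<^sub>u \<subseteq> verts H" "F\<^sub>u \<noteq> {}"
    using F u by (auto simp: F\<^sub>u_def)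
  then obtain v where v: "v \<in> F\<^sub>u" and vb: "(\<Sum>v'\<in>F\<^sub>u. edge_mult H v' v) \<le> b (Some v)"
    using assms(2) unfolding no_forbidden_cone[OF H.sandpile_axioms] by meson
  have mem: "(u, v) \<in> F" "u \<in> verts G" "v \<in> verts H"
    using v F by (auto simp: F\<^sub>u_def)
  \<comment> \<open>The indicator of \<open>F\<close> as weight extends the sum to all vertices,
    where \<open>sum_cart_prod\<close> applies.\<close>
  have "(\<Sum>w\<in>F. edge_mult (cart_prod G H) w (u, v))
      = (\<Sum>w\<in>verts G \<times> verts H. edge_mult (cart_prod G H) w (u, v) * of_bool (w \<in> F))"
    using F(1) fin by (intro sum.mono_neutral_cong_left) auto
  also have "\<dots> = (\<Sum>u'\<in>verts G. edge_mult G u' u * of_bool ((u', v) \<in> F))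
      + (\<Sum>v'\<in>verts H. edge_mult H v' v * of_bool ((u, v') \<in> F))"
    using sum_cart_prod[OF G(1) H(1) mem(2,3), of "\<lambda>w. of_bool (w \<in> F) :: nat"] by simp
  also have "(\<Sum>u'\<in>verts G. edge_mult G u' u * of_bool ((u', v) \<in> F))
      \<le> (\<Sum>u'\<in>verts G. edge_mult G u' u * of_bool (u' \<in> fst ` F))"
    by (intro sum_mono mult_left_mono) (auto simp: image_iff intro: bexI[rotated])
  also have "\<dots> = (\<Sum>u'\<in>fst ` F. edge_mult G u' u)"
    using F(1) fin by (intro sum.mono_neutral_cong_right) auto
  also have "(\<Sum>v'\<in>verts H. edge_mult H v' v * of_bool ((u, v') \<in> F))
      = (\<Sum>v'\<in>F\<^sub>u. edge_mult H v' v)"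
    using F(1) fin by (intro sum.mono_neutral_cong_right) (auto simp: F\<^sub>u_def)
  finally have "(\<Sum>w\<in>F. edge_mult (cart_prod G H) w (u, v)) \<le> box_conf G H a b (Some (u, v))"
    using ua vb mem(2,3) by simp
  with mem(1) show "\<exists>w\<in>F. (\<Sum>w'\<in>F. edge_mult (cart_prod G H) w' w) \<le> box_conf G H a b (Some w)"
    by blast
qed

theorem recurrent_box:
  assumes "recurrent (cone G) cone_sink a" "recurrent (cone H) cone_sink b"
  shows "recurrent (cone (cart_prod G H)) cone_sink (box_conf G H a b)"
proof -
  have "stable (cone (cart_prod G H)) cone_sink (box_conf G H a b)"
    using assms
    by (auto simp: recurrent_def stable_cone[OF G(1)] stable_cone[OF H(1)]
        stable_cone[OF finite_multigraph_cart_prod[OF G(1) H(1)]]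
        degree_cart_prod[OF G(1) H(1)] intro: add_mono)
  then show ?thesis
    using assms no_forbidden_box[of a b]
    by (simp add: GH.recurrent_iff_no_forbidden G.recurrent_iff_no_forbidden
        H.recurrent_iff_no_forbidden box_conf_configs)
qed

text \<open>Scripts \<open>x\<close> and \<open>y\<close> for the two factors combine to the script
  \<open>x u + y v\<close>, and the box of the results is recurrent, so it is the representative
  that the operation produces.\<close>

theorem sandpile_op_box:
  assumes a: "recurrent (cone G) cone_sink a" "recurrent (cone G) cone_sink a'"
    and b: "recurrent (cone H) cone_sink b" "recurrent (cone H) cone_sink b'"
  shows "sandpile_op (cone (cart_prod G H)) cone_sink (box_conf G H a b) (box_conf G H a' b')
    = box_conf G H (sandpile_op (cone G) cone_sink a a') (sandpile_op (cone H) cone_sink b b')"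
proof -
  let ?a = "sandpile_op (cone G) cone_sink a a'" and ?b = "sandpile_op (cone H) cone_sink b b'"
  obtain x where x: "x cone_sink = 0" "\<And>w. w \<in> G.V \<Longrightarrow> int (?a w) = int (a w) + int (a' w) - G.laplacian x w"
    by (rule G.sandpile_op_balance[of a a']) blast
  obtain y where y: "y cone_sink = 0" "\<And>w. w \<in> H.V \<Longrightarrow> int (?b w) = int (b w) + int (b' w) - H.laplacian y w"
    by (rule H.sandpile_op_balance[of b b']) blast
  let ?z = "case_option 0 (\<lambda>(u, v). x (Some u) + y (Some v))"
  show ?thesis
  proof (rule GH.sandpile_op_eqI[where z = ?z])
    have "recurrent (cone G) cone_sink ?a" "recurrent (cone H) cone_sink ?b"
      using G.recurrent_op H.recurrent_op a b by (auto simp: recurrent_def)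
    then show "recurrent (cone (cart_prod G H)) cone_sink (box_conf G H ?a ?b)"
      by (rule recurrent_box)
    fix w assume "w \<in> GH.V"
    then obtain u v where w: "w = Some (u, v)" "u \<in> verts G" "v \<in> verts H"
      unfolding nonsink_cone by auto
    have "Some u \<in> G.V" "Some v \<in> H.V"
      unfolding nonsink_cone using w by auto
    then show "int (box_conf G H ?a ?b w)
        = int (box_conf G H a b w) + int (box_conf G H a' b' w) - GH.laplacian ?z w"
      using x y w laplacian_box[of x y u v] by simp
  qed (use a b recurrent_box in auto)
qed

end

theorem theorem4p4:
  fixes G :: "'a multigraph" and H :: "'b multigraph"
  assumes "finite_multigraph G" and "loopless G" and "connected_multigraph G"
    and "finite_multigraph H" and "loopless H" and "connected_multigraph H"
  shows "group_hom (sandpile_group (cone G) cone_sink)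
           (sandpile_group (cone (cart_prod G H)) cone_sink)
           (\<lambda>a. box_conf G H a \<one>\<^bsub>sandpile_group (cone H) cone_sink\<^esub>)
       \<and> inj_on (\<lambda>a. box_conf G H a \<one>\<^bsub>sandpile_group (cone H) cone_sink\<^esub>)
           (carrier (sandpile_group (cone G) cone_sink))"
proof -
  interpret sandpile_cone_prod G H
    by (rule sandpile_cone_prod.intro) fact+
  let ?e = "sandpile_identity (cone H) cone_sink"
  \<comment> \<open>In \<open>sandpile_op_box\<close> the second component becomes
    \<open>?e \<oplus> ?e = ?e\<close>.\<close>
  have "(\<lambda>a. box_conf G H a ?e)
      \<in> hom (sandpile_group (cone G) cone_sink) (sandpile_group (cone (cart_prod G H)) cone_sink)"
    using sandpile_op_box[of _ _ ?e ?e] recurrent_box[of _ ?e] H.recurrent_identity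
    by (auto simp: hom_def sandpile_group_def H.sandpile_op_identity)
  then have "group_hom (sandpile_group (cone G) cone_sink)
      (sandpile_group (cone (cart_prod G H)) cone_sink) (\<lambda>a. box_conf G H a ?e)"
    by (intro group_hom.intro group_hom_axioms.intro G.group_sandpile_group GH.group_sandpile_group)
  moreover have "inj_on (\<lambda>a. box_conf G H a ?e) (carrier (sandpile_group (cone G) cone_sink))"
    by (rule inj_on_subset[OF inj_on_box_conf])
      (use H(3) in \<open>auto simp: sandpile_group_def recurrent_def connected_multigraph_def\<close>)
  ultimately show ?thesis
    by (simp add: sandpile_group_def)
qed

end
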